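(* Let $2 \le k \le n$, let $G$ be a subgroup of $S_n$ and let $H$ be a subgroup of $S_n$ conjugate to $G$, i.e. $H = \sigma G \sigma^{-1}$ for some $\sigma \in S_n$. Suppose there is a ${\rm PSCA}(n,k,\lambda)$ that is a union of distinct left cosets of $H$. Then there is a ${\rm PSCA}(n,k,\lambda)$ which is a union of distinct left cosets of $G$.
   Context: $S_n$ is the symmetric group on $[n]=\{1,\dots,n\}$, each permutation identified with the sequence $(x(1),\dots,x(n))$ of its values; $S_{n,k}$ is the set of sequences of $k$ distinct elements of $[n]$. Composition convention: $\pi\sigma$ means $\pi$ followed by $\sigma$. A left coset of $H$ is $\pi H = \{\pi h : h \in H\}$. A sequence $x \in S_n$ covers $y \in S_{n,k}$ if $y$ is a (not necessarily contiguous) subsequence of $x$. A ${\rm PSCA}(n,k,\lambda)$ is a multiset $P$ of elements of $S_n$ such that every $y \in S_{n,k}$ is covered by exactly $\lambda$ elements of $P$, counted with multiplicity. *)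

theory Defs
  imports
    "HOL-Algebra.Sym_Groups"
    "HOL-Algebra.Left_Coset"
    "HOL-Library.Sublist"
    "HOL-Library.Multiset"
begin

text \<open>
  The library's \<^const>\<open>sym_group\<close> multiplies permutations by \<^term>\<open>(\<circ>)\<close>, i.e.\ the right factor
  acts first. Here \<open>\<pi>\<sigma>\<close> means \<open>\<pi>\<close> followed by \<open>\<sigma>\<close>, so the
  multiplication is reversed. The order matters: with this convention the members of a left coset
  of \<open>H\<close> arise from one sequence by applying the elements of \<open>H\<close> to its entries.
\<close>

definition sym_group_lr :: "nat \<Rightarrow> (nat \<Rightarrow> nat) monoid" where
  "sym_group_lr n = (sym_group n) \<lparr>mult := (\<lambda>\<pi> \<sigma>. \<sigma> \<circ> \<pi>)\<rparr>"

lemma carrier_sym_group_lr: "\<pi> \<in> carrier (sym_group_lr n) \<longleftrightarrow> \<pi> permutes {1..n}"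
  by (simp add: sym_group_lr_def sym_group_def)

lemma mult_sym_group_lr: "\<pi> \<otimes>\<^bsub>sym_group_lr n\<^esub> \<sigma> = \<sigma> \<circ> \<pi>"
  by (simp add: sym_group_lr_def)

lemma one_sym_group_lr: "\<one>\<^bsub>sym_group_lr n\<^esub> = id"
  by (simp add: sym_group_lr_def sym_group_def)

lemma group_sym_group_lr: "group (sym_group_lr n)"
proof (rule groupI)
  fix \<pi> assume "\<pi> \<in> carrier (sym_group_lr n)"
  then have "inv_into UNIV \<pi> \<in> carrier (sym_group_lr n)"
    and "inv_into UNIV \<pi> \<otimes>\<^bsub>sym_group_lr n\<^esub> \<pi> = \<one>\<^bsub>sym_group_lr n\<^esub>"
    by (simp_all add: carrier_sym_group_lr mult_sym_group_lr one_sym_group_lr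
        permutes_inv permutes_inv_o)
  then show "\<exists>\<sigma>\<in>carrier (sym_group_lr n). \<sigma> \<otimes>\<^bsub>sym_group_lr n\<^esub> \<pi> = \<one>\<^bsub>sym_group_lr n\<^esub>"
    by blast
qed (auto simp: carrier_sym_group_lr mult_sym_group_lr one_sym_group_lr
      permutes_compose permutes_id o_assoc)

definition perm_seq :: "nat \<Rightarrow> (nat \<Rightarrow> nat) \<Rightarrow> nat list" where
  "perm_seq n x = map x [1..<n+1]"

definition partial_seqs :: "nat \<Rightarrow> nat \<Rightarrow> nat list set" where
  "partial_seqs n k = {ys. length ys = k \<and> distinct ys \<and> set ys \<subseteq> {1..n}}"

definition covers :: "nat \<Rightarrow> (nat \<Rightarrow> nat) \<Rightarrow> nat list \<Rightarrow> bool" where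
  "covers n x ys \<longleftrightarrow> subseq ys (perm_seq n x)"

definition PSCA :: "nat \<Rightarrow> nat \<Rightarrow> nat \<Rightarrow> (nat \<Rightarrow> nat) multiset \<Rightarrow> bool" where
  "PSCA n k l P \<longleftrightarrow>
     set_mset P \<subseteq> carrier (sym_group_lr n) \<and>
     (\<forall>ys\<in>partial_seqs n k. size {#x \<in># P. covers n x ys#} = l)"

text \<open>Distinct left cosets of a subgroup are disjoint, so such a union has no repeated elements.\<close>

definition union_of_left_cosets :: "nat \<Rightarrow> (nat \<Rightarrow> nat) set \<Rightarrow> (nat \<Rightarrow> nat) multiset \<Rightarrow> bool" where
  "union_of_left_cosets n H P \<longleftrightarrow>
     (\<exists>\<C>. \<C> \<subseteq> lcosets\<^bsub>sym_group_lr n\<^esub> H \<and> P = mset_set (\<Union>\<C>))"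

end

theory Submission
  imports Defs
begin

text \<open>
  Relabelling the entries of every sequence by \<open>\<sigma>\<close>, i.e.\ replacing \<open>\<pi>\<close> by \<open>\<pi>\<sigma>\<close>, permutes the
  elements of \<open>S\<^sub>n\<^sub>,\<^sub>k\<close> and preserves covering, so it maps a PSCA to a PSCA with the same
  parameters. It sends the left coset \<open>\<pi>(\<sigma>G\<sigma>\<inverse>)\<close> to \<open>(\<pi>\<sigma>)G\<close>.
\<close>

text \<open>Associativity brings the outer \<open>s\<close> next to \<open>inv s\<close>, where the
  two cancel; the remaining left factors \<open>a\<close> and \<open>s\<close> merge.\<close>

lemma (in group) l_coset_conjugate_r_coset:
  assumes "M \<subseteq> carrier G" and a: "a \<in> carrier G" and s: "s \<in> carrier G"
  shows "a <# (s <# M #> inv s) #> s = (a \<otimes> s) <# M"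
proof -
  have sM: "s <# M \<subseteq> carrier G"
    using assms by (simp add: l_coset_subset_G)
  then have "a <# (s <# M #> inv s) #> s = a <# (s <# M #> inv s #> s)"
    using a s by (simp add: coset_assoc r_coset_subset_G)
  also have "\<dots> = a <# (s <# M)"
    using s sM by (simp add: coset_mult_assoc coset_mult_one)
  also have "\<dots> = (a \<otimes> s) <# M"
    using assms by (simp add: lcos_m_assoc)
  finally show ?thesis .
qed

lemma subseq_map_inj_iff:
  assumes "inj f"
  shows "subseq (map f xs) (map f ys) \<longleftrightarrow> subseq xs ys"
proof
  assume "subseq (map f xs) (map f ys)"
  \<comment> \<open>By injectivity, \<open>inv_into UNIV f\<close> is a left inverse of
    \<open>f\<close>, so mapping it over both lists undoes \<open>map f\<close>.\<close>
  then have "subseq (map (inv_into UNIV f) (map f xs)) (map (inv_into UNIV f) (map f ys))"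
    by (rule subseq_map)
  then show "subseq xs ys"
    using assms by simp
qed (rule subseq_map)

text \<open>The sequence of \<open>s \<circ> x\<close> is the sequence of \<open>x\<close> with
  \<open>s\<close> mapped over it.\<close>

lemma covers_comp_iff:
  assumes "inj s"
  shows "covers n (s \<circ> x) (map s ys) \<longleftrightarrow> covers n x ys"
  using subseq_map_inj_iff[OF assms, of ys "perm_seq n x"]
  by (simp add: covers_def perm_seq_def)

lemma map_permutes_partial_seqs:
  assumes "s permutes {1..n}" and "ys \<in> partial_seqs n k"
  shows "map s ys \<in> partial_seqs n k"
  using assms permutes_image[OF assms(1)] permutes_inj_on[OF assms(1)]
  unfolding partial_seqs_def by (auto simp: distinct_map)

lemma PSCA_image_comp:
  assumes s: "s permutes {1..n}" and P: "PSCA n k l P"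
  shows "PSCA n k l (image_mset ((\<circ>) s) P)"
  unfolding PSCA_def
proof (intro conjI ballI)
  show "set_mset (image_mset ((\<circ>) s) P) \<subseteq> carrier (sym_group_lr n)"
    using P permutes_compose[OF _ s] by (fastforce simp: PSCA_def carrier_sym_group_lr)
next
  fix ys assume ys: "ys \<in> partial_seqs n k"
  \<comment> \<open>Pulling \<open>ys\<close> back along \<open>s\<close> turns the count for
    \<open>ys\<close> in the image into the count for \<open>zs\<close> in \<open>P\<close>, which
    is \<open>l\<close>.\<close>
  define zs where "zs = map (inv_into UNIV s) ys"
  have zs: "zs \<in> partial_seqs n k"
    unfolding zs_def using ys by (rule map_permutes_partial_seqs[OF permutes_inv[OF s]])
  have "ys = map s zs"
    by (simp add: zs_def permutes_inv_o(1)[OF s])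
  then have "covers n (s \<circ> x) ys \<longleftrightarrow> covers n x zs" for x
    by (simp add: covers_comp_iff permutes_inj[OF s])
  then have "size {#x \<in># image_mset ((\<circ>) s) P. covers n x ys#} = size {#x \<in># P. covers n x zs#}"
    by (simp add: filter_mset_image_mset)
  then show "size {#x \<in># image_mset ((\<circ>) s) P. covers n x ys#} = l"
    using P zs by (simp add: PSCA_def)
qed

lemma union_of_left_cosets_image_comp:
  assumes G: "G \<subseteq> carrier (sym_group_lr n)" and s: "s \<in> carrier (sym_group_lr n)"
    and P: "union_of_left_cosets n
      (s <#\<^bsub>sym_group_lr n\<^esub> G #>\<^bsub>sym_group_lr n\<^esub> inv\<^bsub>sym_group_lr n\<^esub> s) P"
  shows "union_of_left_cosets n G (image_mset ((\<circ>) s) P)"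
proof -
  interpret S: group "sym_group_lr n" by (rule group_sym_group_lr)
  let ?H = "s <#\<^bsub>sym_group_lr n\<^esub> G #>\<^bsub>sym_group_lr n\<^esub> inv\<^bsub>sym_group_lr n\<^esub> s"
  from P obtain C where C: "C \<subseteq> lcosets\<^bsub>sym_group_lr n\<^esub> ?H" "P = mset_set (\<Union>C)"
    by (auto simp: union_of_left_cosets_def)
  \<comment> \<open>As the product is reversed composition, composing with \<open>s\<close> on the
    outside is multiplication by \<open>s\<close> on the right.\<close>
  have image_eq: "(\<circ>) s ` X = X #>\<^bsub>sym_group_lr n\<^esub> s" for X
    by (auto simp: r_coset_def mult_sym_group_lr)
  \<comment> \<open>Injectivity keeps multiplicities at one, so the image multiset is again the
    \<open>mset_set\<close> of a union.\<close>
  have "inj ((\<circ>) s)"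
    using s by (simp add: fun.inj_map permutes_inj carrier_sym_group_lr)
  then have "image_mset ((\<circ>) s) P = mset_set (\<Union>((`) ((\<circ>) s) ` C))"
    unfolding C(2) image_Union[symmetric]
    by (intro image_mset_mset_set) (erule inj_on_subset, rule subset_UNIV)
  moreover have "(\<circ>) s ` X \<in> lcosets\<^bsub>sym_group_lr n\<^esub> G" if "X \<in> C" for X
  proof -
    from that C(1) obtain a where "a \<in> carrier (sym_group_lr n)"
      and "X = a <#\<^bsub>sym_group_lr n\<^esub> ?H"
      by (auto simp: LCOSETS_def)
    \<comment> \<open>The image of \<open>X\<close> is the left coset of \<open>G\<close> with
      representative \<open>a \<otimes> s\<close>.\<close>
    then show ?thesis
      using S.l_coset_conjugate_r_coset[OF G _ s] s
      by (auto simp: image_eq LCOSETS_def)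
  qed
  ultimately show ?thesis
    unfolding union_of_left_cosets_def by blast
qed

theorem theorem4p4:
  fixes n k l :: nat and G H :: "(nat \<Rightarrow> nat) set" and \<sigma> :: "nat \<Rightarrow> nat"
  assumes "2 \<le> k" and "k \<le> n"
    and "subgroup G (sym_group_lr n)"
    and "subgroup H (sym_group_lr n)"
    and "\<sigma> \<in> carrier (sym_group_lr n)"
    and "H = \<sigma> <#\<^bsub>sym_group_lr n\<^esub> G #>\<^bsub>sym_group_lr n\<^esub> inv\<^bsub>sym_group_lr n\<^esub> \<sigma>"
    and "\<exists>P. PSCA n k l P \<and> union_of_left_cosets n H P"
  shows "\<exists>Q. PSCA n k l Q \<and> union_of_left_cosets n G Q"
  \<comment> \<open>The witness \<open>Q\<close> is
    \<open>image_mset ((\<circ>) \<sigma>) P\<close>.\<close>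
  using assms subgroup.subset[of G] PSCA_image_comp union_of_left_cosets_image_comp
  by (metis carrier_sym_group_lr)

end
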